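(* Let $G$ be a finite group which is the internal central product $G = U_1U_2$ of subgroups $U_1, U_2 \leq G$. Let $D = U_1\times U_2$ be the external direct product, let $\overline{U}_1=\{(u_1,1) : u_1\in U_1\}$ and $\overline{U}_2=\{(1,u_2) : u_2\in U_2\}$, and let $\varepsilon : D \to G$ be an epimorphism with $\varepsilon(\overline{U}_i)=U_i$ for $i=1,2$. Let $H \leq G$. Then the following are equivalent: (1) $H\unlhd G$. (2) $\varepsilon^{-1}(H)\unlhd D$. (3) $[\overline{U}_i, \varepsilon^{-1}(H)]\leq \overline{U}_i\cap \varepsilon^{-1}(H)$ for $i=1,2$. (4) $[U_i, H]\leq H\cap U_i$ for $i=1,2$.
   Context: $G$ is an internal central product of subgroups $U_1,U_2\leq G$ if $G=U_1U_2$ and $[U_1,U_2]=1$. For elements, $[a,b]=a^{-1}b^{-1}ab$; for subgroups $A,B$, $[A,B]$ denotes the subgroup generated by all $[a,b]$ with $a\in A$, $b\in B$. $\varepsilon^{-1}(H)$ is the full preimage of $H$. *)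

theory Defs
  imports "HOL-Algebra.Generated_Groups"
begin

text \<open>The convention is \<open>[a,b] = a\<inverse> b\<inverse> a b\<close>; it differs from the \<open>a b a\<inverse> b\<inverse>\<close> used in the
  library's \<open>derived_set\<close>.\<close>

definition commutator :: "('a, 'b) monoid_scheme \<Rightarrow> 'a \<Rightarrow> 'a \<Rightarrow> 'a" where
  "commutator G a b = inv\<^bsub>G\<^esub> a \<otimes>\<^bsub>G\<^esub> inv\<^bsub>G\<^esub> b \<otimes>\<^bsub>G\<^esub> a \<otimes>\<^bsub>G\<^esub> b"

definition commutator_subgroup :: "('a, 'b) monoid_scheme \<Rightarrow> 'a set \<Rightarrow> 'a set \<Rightarrow> 'a set" where
  "commutator_subgroup G A B = generate G {commutator G a b |a b. a \<in> A \<and> b \<in> B}"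

definition internal_central_product ::
    "('a, 'b) monoid_scheme \<Rightarrow> 'a set \<Rightarrow> 'a set \<Rightarrow> bool" where
  "internal_central_product G U1 U2 \<longleftrightarrow>
     subgroup U1 G \<and> subgroup U2 G \<and>
     carrier G = U1 <#>\<^bsub>G\<^esub> U2 \<and> commutator_subgroup G U1 U2 = {\<one>\<^bsub>G\<^esub>}"

text \<open>The preimage is taken inside \<open>carrier D\<close>, since \<open>f\<close> is unconstrained elsewhere.\<close>

definition full_preimage ::
    "('a, 'b) monoid_scheme \<Rightarrow> ('a \<Rightarrow> 'c) \<Rightarrow> 'c set \<Rightarrow> 'a set" where
  "full_preimage D f H = {d \<in> carrier D. f d \<in> H}"

end

theory Submission
  imports Defs
begin

text \<open>In an internal central product each factor \<open>U\<^sub>i\<close> centralises the other and is therefore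
  normal. Hence if \<open>H\<close> is normal, \<open>[U\<^sub>i, H]\<close> lies in \<open>H \<inter> U\<^sub>i\<close>; conversely, \<open>[U\<^sub>i, H] \<le> H\<close> says
  that \<open>U\<^sub>i\<close> normalises \<open>H\<close>, and so does \<open>G = U\<^sub>1U\<^sub>2\<close>. This argument applies to \<open>H\<close> in \<open>G\<close> and,
  since \<open>D\<close> is an internal central product of the embedded factors, to \<open>\<epsilon>\<inverse>(H)\<close> in \<open>D\<close>. The two are
  linked because normality is preserved and reflected by preimages under an epimorphism.\<close>

context group
begin

lemma commutator_eq_one_iff:
  assumes a: "a \<in> carrier G" and b: "b \<in> carrier G"
  shows "commutator G a b = \<one> \<longleftrightarrow> a \<otimes> b = b \<otimes> a"
proof -
  have "commutator G a b = inv (b \<otimes> a) \<otimes> (a \<otimes> b)"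
    using a b by (simp add: commutator_def inv_mult_group m_assoc)
  then show ?thesis
    using a b by (metis inv_closed inv_equality inv_inv l_inv m_closed)
qed

text \<open>With this convention \<open>commutator G a b\<close> contains the conjugate by
  \<open>inv a\<close>; passing to inverses exposes \<open>a \<otimes> b \<otimes> inv a\<close>,
  the form of conjugate that \<open>normal_inv_iff\<close> asks for.\<close>

lemma commutator_inv_inv:
  assumes "a \<in> carrier G" "b \<in> carrier G"
  shows "commutator G (inv a) (inv b) = a \<otimes> b \<otimes> inv a \<otimes> inv b"
  using assms by (simp add: commutator_def)

lemma commutator_subgroup_subset:
  assumes "subgroup K G" "\<And>a b. \<lbrakk>a \<in> A; b \<in> B\<rbrakk> \<Longrightarrow> commutator G a b \<in> K"
  shows "commutator_subgroup G A B \<subseteq> K"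
  unfolding commutator_subgroup_def using assms by (intro generate_subgroup_incl) auto

lemma commutator_in_commutator_subgroup:
  "\<lbrakk>a \<in> A; b \<in> B\<rbrakk> \<Longrightarrow> commutator G a b \<in> commutator_subgroup G A B"
  unfolding commutator_subgroup_def by (auto intro: generate.incl)

text \<open>Bridges the generated subgroup in \<open>internal_central_product\<close> and
  elementwise commutation, which is what the later arguments use and verify.\<close>

lemma commutator_subgroup_trivial_iff:
  assumes "A \<subseteq> carrier G" "B \<subseteq> carrier G"
  shows "commutator_subgroup G A B = {\<one>} \<longleftrightarrow> (\<forall>a\<in>A. \<forall>b\<in>B. a \<otimes> b = b \<otimes> a)"
proof
  assume L: "commutator_subgroup G A B = {\<one>}"
  show "\<forall>a\<in>A. \<forall>b\<in>B. a \<otimes> b = b \<otimes> a"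
  proof (intro ballI)
    fix a b assume "a \<in> A" "b \<in> B"
    then show "a \<otimes> b = b \<otimes> a"
      using L commutator_in_commutator_subgroup[of a A b B] commutator_eq_one_iff[of a b] assms
      by auto
  qed
next
  assume "\<forall>a\<in>A. \<forall>b\<in>B. a \<otimes> b = b \<otimes> a"
  then have "commutator_subgroup G A B \<subseteq> {\<one>}"
    using assms
    by (intro commutator_subgroup_subset triv_subgroup) (auto simp: commutator_eq_one_iff subset_iff)
  moreover have "\<one> \<in> commutator_subgroup G A B"
    unfolding commutator_subgroup_def by (rule generate.one)
  ultimately show "commutator_subgroup G A B = {\<one>}" by auto
qed

text \<open>Bracketed as \<open>inv a \<otimes> (inv b \<otimes> a \<otimes> b)\<close>, each
  generator is an inverse from \<open>N\<close> times a conjugate of an element of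
  \<open>N\<close>.\<close>

lemma commutator_subgroup_subset_left:
  assumes "N \<lhd> G" "B \<subseteq> carrier G"
  shows "commutator_subgroup G N B \<subseteq> N"
proof (rule commutator_subgroup_subset)
  show N: "subgroup N G" by (rule normal_imp_subgroup[OF assms(1)])
  fix a b assume ab: "a \<in> N" "b \<in> B"
  then have c: "a \<in> carrier G" "b \<in> carrier G" using N assms subgroup.mem_carrier by auto
  then have "inv b \<otimes> a \<otimes> b \<in> N"
    using normal.inv_op_closed1[OF assms(1)] ab by blast
  then have "inv a \<otimes> (inv b \<otimes> a \<otimes> b) \<in> N"
    using N ab by (blast intro: subgroup.m_closed subgroup.m_inv_closed)
  then show "commutator G a b \<in> N" using c by (simp add: commutator_def m_assoc)
qed

text \<open>Here the bracketing is \<open>(inv a \<otimes> inv b \<otimes> a) \<otimes> b\<close>: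
  the conjugate comes first and \<open>b\<close> itself lies in \<open>N\<close>.\<close>

lemma commutator_subgroup_subset_right:
  assumes "N \<lhd> G" "A \<subseteq> carrier G"
  shows "commutator_subgroup G A N \<subseteq> N"
proof (rule commutator_subgroup_subset)
  show N: "subgroup N G" by (rule normal_imp_subgroup[OF assms(1)])
  fix a b assume ab: "a \<in> A" "b \<in> N"
  then have c: "a \<in> carrier G" "b \<in> carrier G" using N assms subgroup.mem_carrier by auto
  then have "inv a \<otimes> inv b \<otimes> a \<in> N"
    using normal.inv_op_closed1[OF assms(1)] N ab by (blast intro: subgroup.m_inv_closed)
  then show "commutator G a b \<in> N"
    using N ab by (auto simp: commutator_def intro: subgroup.m_closed)
qed

text \<open>The conjugate equals \<open>commutator G (inv u) (inv h) \<otimes> h\<close>, a product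
  of two elements of \<open>H\<close>.\<close>

lemma conjugate_closed_if_commutator_subgroup_subset:
  assumes "subgroup U G" "subgroup H G" "commutator_subgroup G U H \<subseteq> H" "u \<in> U" "h \<in> H"
  shows "u \<otimes> h \<otimes> inv u \<in> H"
proof -
  have c: "u \<in> carrier G" "h \<in> carrier G"
    using assms(4,5) by (simp_all add: subgroup.mem_carrier[OF assms(1)] subgroup.mem_carrier[OF assms(2)])
  have "commutator G (inv u) (inv h) \<in> H"
    using assms(3) commutator_in_commutator_subgroup[OF
        subgroup.m_inv_closed[OF assms(1,4)] subgroup.m_inv_closed[OF assms(2,5)]]
    by (rule subsetD)
  then have "u \<otimes> h \<otimes> inv u \<otimes> inv h \<otimes> h \<in> H"
    using c subgroup.m_closed[OF assms(2) _ assms(5)] by (simp add: commutator_inv_inv)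
  then show ?thesis using c by (simp add: m_assoc)
qed

text \<open>Conjugation by \<open>a \<otimes> b\<close> is conjugation by \<open>b\<close> followed
  by conjugation by \<open>a\<close>.\<close>

lemma normal_if_factors_normalise:
  assumes N: "subgroup N G" and prod: "carrier G = A <#> B"
    and AB: "A \<subseteq> carrier G" "B \<subseteq> carrier G"
    and A: "\<And>a n. \<lbrakk>a \<in> A; n \<in> N\<rbrakk> \<Longrightarrow> a \<otimes> n \<otimes> inv a \<in> N"
    and B: "\<And>b n. \<lbrakk>b \<in> B; n \<in> N\<rbrakk> \<Longrightarrow> b \<otimes> n \<otimes> inv b \<in> N"
  shows "N \<lhd> G"
  unfolding normal_inv_iff
proof (intro conjI ballI N)
  fix x n assume x: "x \<in> carrier G" and n: "n \<in> N"
  from x obtain a b where ab: "a \<in> A" "b \<in> B" "x = a \<otimes> b"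
    unfolding prod set_mult_def by auto
  have c: "a \<in> carrier G" "b \<in> carrier G" "n \<in> carrier G"
    using ab AB n N subgroup.mem_carrier by auto
  have "a \<otimes> (b \<otimes> n \<otimes> inv b) \<otimes> inv a \<in> N" using A B ab n by blast
  then show "x \<otimes> n \<otimes> inv x \<in> N" using ab c by (simp add: inv_mult_group m_assoc)
qed

lemma internal_central_product_normal:
  assumes "internal_central_product G U1 U2"
  shows "U1 \<lhd> G" and "U2 \<lhd> G"
proof -
  have U: "subgroup U1 G" "subgroup U2 G" and prod: "carrier G = U1 <#> U2"
    and triv: "commutator_subgroup G U1 U2 = {\<one>}"
    using assms by (auto simp: internal_central_product_def)
  have sub: "U1 \<subseteq> carrier G" "U2 \<subseteq> carrier G" using U subgroup.subset by auto
  have comm: "\<And>a b. \<lbrakk>a \<in> U1; b \<in> U2\<rbrakk> \<Longrightarrow> a \<otimes> b = b \<otimes> a"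
    using triv commutator_subgroup_trivial_iff[OF sub] by blast
  have self: "u \<otimes> v \<otimes> inv u \<in> U" if "subgroup U G" "u \<in> U" "v \<in> U" for U u v
    using that by (auto intro: subgroup.m_closed subgroup.m_inv_closed)
  \<comment> \<open>Each factor is closed under conjugation by itself (\<open>self\<close>) and
    fixed pointwise under conjugation by the other, so both factors normalise it.\<close>
  have fix1: "b \<otimes> a \<otimes> inv b = a" and fix2: "a \<otimes> b \<otimes> inv a = b" if "a \<in> U1" "b \<in> U2" for a b
  proof -
    have c: "a \<in> carrier G" "b \<in> carrier G" using that sub by auto
    show "b \<otimes> a \<otimes> inv b = a" using c comm[OF that] by (metis inv_solve_right m_closed)
    show "a \<otimes> b \<otimes> inv a = b" using c comm[OF that] by (metis inv_solve_right m_closed)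
  qed
  show "U1 \<lhd> G"
    by (rule normal_if_factors_normalise[OF U(1) prod sub]) (simp_all add: self[OF U(1)] fix1)
  show "U2 \<lhd> G"
    by (rule normal_if_factors_normalise[OF U(2) prod sub]) (simp_all add: self[OF U(2)] fix2)
qed

text \<open>Kept general in the group because it serves twice: for \<open>H\<close> in
  \<open>G\<close> it gives (1) \<longleftrightarrow> (4), for the preimage in \<open>D\<close> it
  gives (2) \<longleftrightarrow> (3).\<close>

lemma normal_iff_commutator_subgroups:
  assumes icp: "internal_central_product G U1 U2" and H: "subgroup H G"
  shows "H \<lhd> G \<longleftrightarrow>
    commutator_subgroup G U1 H \<subseteq> U1 \<inter> H \<and> commutator_subgroup G U2 H \<subseteq> U2 \<inter> H"
proof -
  have U: "subgroup U1 G" "subgroup U2 G" and prod: "carrier G = U1 <#> U2"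
    using icp by (auto simp: internal_central_product_def)
  note sub = U[THEN subgroup.subset]
  show ?thesis
  proof
    assume "H \<lhd> G"
    then show "commutator_subgroup G U1 H \<subseteq> U1 \<inter> H \<and> commutator_subgroup G U2 H \<subseteq> U2 \<inter> H"
      using internal_central_product_normal[OF icp] sub subgroup.subset[OF H]
      by (simp add: commutator_subgroup_subset_left commutator_subgroup_subset_right)
  next
    assume "commutator_subgroup G U1 H \<subseteq> U1 \<inter> H \<and> commutator_subgroup G U2 H \<subseteq> U2 \<inter> H"
    then show "H \<lhd> G"
      using U H by (intro normal_if_factors_normalise[OF H prod sub]
          conjugate_closed_if_commutator_subgroup_subset) auto
  qed
qed

text \<open>Both \<open>(u, \<one>)(\<one>, v)\<close> and \<open>(\<one>, v)(u, \<one>)\<close>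
  equal \<open>(u, v)\<close>, whether or not \<open>u\<close> and \<open>v\<close> commute in
  \<open>G\<close>.\<close>

lemma internal_central_product_DirProd:
  assumes U: "subgroup U G" and V: "subgroup V G"
  shows "internal_central_product (G\<lparr>carrier := U\<rparr> \<times>\<times> G\<lparr>carrier := V\<rparr>)
    {(u, \<one>) |u. u \<in> U} {(\<one>, v) |v. v \<in> V}"
proof -
  let ?D = "G\<lparr>carrier := U\<rparr> \<times>\<times> G\<lparr>carrier := V\<rparr>"
  interpret U: group "G\<lparr>carrier := U\<rparr>" using U by (rule subgroup_imp_group)
  interpret V: group "G\<lparr>carrier := V\<rparr>" using V by (rule subgroup_imp_group)
  interpret D: group ?D by (rule DirProd_group) unfold_locales
  have c: "u \<in> U \<Longrightarrow> u \<in> carrier G" "v \<in> V \<Longrightarrow> v \<in> carrier G" for u v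
    using U V by (auto dest: subgroup.mem_carrier)
  have U': "{(u, \<one>) |u. u \<in> U} = U \<times> {\<one>}" and V': "{(\<one>, v) |v. v \<in> V} = {\<one>} \<times> V" by auto
  have sub: "subgroup (U \<times> {\<one>}) ?D" "subgroup ({\<one>} \<times> V) ?D"
    \<comment> \<open>Each embedded factor is the product of the whole group in one coordinate and
      the trivial subgroup in the other.\<close>
    using DirProd_subgroups[OF U.is_group U.subgroup_self V.is_group V.triv_subgroup]
      DirProd_subgroups[OF U.is_group U.triv_subgroup V.is_group V.subgroup_self]
    by simp_all
  have "carrier ?D = U \<times> {\<one>} <#>\<^bsub>?D\<^esub> {\<one>} \<times> V"
    by (auto simp: set_mult_def DirProd_def c)
  moreover have "commutator_subgroup ?D (U \<times> {\<one>}) ({\<one>} \<times> V) = {\<one>\<^bsub>?D\<^esub>}"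
    using sub[THEN subgroup.subset] by (subst D.commutator_subgroup_trivial_iff) (auto simp: c)
  ultimately show ?thesis
    unfolding internal_central_product_def U' V' using sub by simp
qed

end

context group_hom
begin

lemma subgroup_full_preimage:
  assumes K: "subgroup K H"
  shows "subgroup (full_preimage G h K) G"
  using subgroup.one_closed[OF K]
  by unfold_locales
    (auto simp: full_preimage_def subgroup.m_closed[OF K] subgroup.m_inv_closed[OF K])

text \<open>In this locale \<open>H\<close> is the target group; the subgroup is \<open>K\<close>.
  Surjectivity matters only for reflecting normality, where the conjugating element has to be
  lifted.\<close>

lemma normal_full_preimage_iff:
  assumes K: "subgroup K H" and surj: "h ` carrier G = carrier H"
  shows "full_preimage G h K \<lhd> G \<longleftrightarrow> K \<lhd> H"
proof
  assume "K \<lhd> H"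
  then show "full_preimage G h K \<lhd> G"
    using subgroup_full_preimage[OF K]
    by (auto simp: G.normal_inv_iff H.normal_inv_iff full_preimage_def)
next
  assume N: "full_preimage G h K \<lhd> G"
  show "K \<lhd> H"
    unfolding H.normal_inv_iff
  proof (intro conjI ballI K)
    fix y k assume y: "y \<in> carrier H" and k: "k \<in> K"
    \<comment> \<open>Lift \<open>y\<close> and \<open>k\<close> to \<open>x\<close> and
      \<open>g\<close>. As \<open>g\<close> lies in the preimage, so does its conjugate by
      \<open>x\<close>, and \<open>h\<close> maps that conjugate to the one wanted in
      \<open>K\<close>.\<close>
    obtain x where x: "x \<in> carrier G" "y = h x" using y surj by auto
    obtain g where g: "g \<in> carrier G" "k = h g" using subgroup.mem_carrier[OF K k] surj by auto
    have "x \<otimes>\<^bsub>G\<^esub> g \<otimes>\<^bsub>G\<^esub> inv\<^bsub>G\<^esub> x \<in> full_preimage G h K"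
      using N x g k by (auto simp: G.normal_inv_iff full_preimage_def)
    then show "y \<otimes>\<^bsub>H\<^esub> k \<otimes>\<^bsub>H\<^esub> inv\<^bsub>H\<^esub> y \<in> K"
      using x g by (simp add: full_preimage_def)
  qed
qed

end

theorem theorem4p4:
  fixes G :: "('a, 'b) monoid_scheme"
    and U1 U2 H :: "'a set"
    and D :: "('a \<times> 'a) monoid"
    and U1bar U2bar :: "('a \<times> 'a) set"
    and \<epsilon> :: "'a \<times> 'a \<Rightarrow> 'a"
  assumes "group G" and "finite (carrier G)"
    and "internal_central_product G U1 U2"
    and "D = (G\<lparr>carrier := U1\<rparr>) \<times>\<times> (G\<lparr>carrier := U2\<rparr>)"
    and "U1bar = {(u1, \<one>\<^bsub>G\<^esub>) |u1. u1 \<in> U1}"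
    and "U2bar = {(\<one>\<^bsub>G\<^esub>, u2) |u2. u2 \<in> U2}"
    and "\<epsilon> \<in> epi D G"
    and "\<epsilon> ` U1bar = U1" and "\<epsilon> ` U2bar = U2"
    and "subgroup H G"
  shows "(H \<lhd> G \<longleftrightarrow> full_preimage D \<epsilon> H \<lhd> D)
       \<and> (H \<lhd> G \<longleftrightarrow>
            commutator_subgroup D U1bar (full_preimage D \<epsilon> H) \<subseteq> U1bar \<inter> full_preimage D \<epsilon> H
          \<and> commutator_subgroup D U2bar (full_preimage D \<epsilon> H) \<subseteq> U2bar \<inter> full_preimage D \<epsilon> H)
       \<and> (H \<lhd> G \<longleftrightarrow>
            commutator_subgroup G U1 H \<subseteq> H \<inter> U1
          \<and> commutator_subgroup G U2 H \<subseteq> H \<inter> U2)"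
proof -
  interpret G: group G by fact
  have U: "subgroup U1 G" "subgroup U2 G"
    using assms(3) by (auto simp: internal_central_product_def)
  interpret D: group D
    unfolding assms(4) by (intro DirProd_group G.subgroup_imp_group U)
  interpret \<epsilon>: group_hom D G \<epsilon>
    using assms(7) by unfold_locales (simp add: epi_def)
  have surj: "\<epsilon> ` carrier D = carrier G" using assms(7) by (simp add: epi_def)
  have D: "internal_central_product D U1bar U2bar"
    unfolding assms(4-6) by (rule G.internal_central_product_DirProd[OF U])
  show ?thesis
    \<comment> \<open>The three facts are (1) \<longleftrightarrow> (2), (2) \<longleftrightarrow>
      (3) and (1) \<longleftrightarrow> (4); \<open>Int_commute\<close> reconciles the order of the
      intersections in (4).\<close>
    using \<epsilon>.normal_full_preimage_iff[OF assms(10) surj]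
      D.normal_iff_commutator_subgroups[OF D \<epsilon>.subgroup_full_preimage[OF assms(10)]]
      G.normal_iff_commutator_subgroups[OF assms(3,10)]
    by (simp add: Int_commute)
qed

end
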